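(* Let $\Omega\subseteq\mathbb{R}^n$ and $f:\Omega\to\mathbb{R}^n$ with solution map $\phi_f$, let $G\subseteq\Omega$ be forward invariant for $f$, and let $\alpha_1,\alpha_2:G\to\mathbb{R}_+$ be continuous. For $\rho:\mathbb{R}_+\to\mathbb{R}$, let $\beta:\mathbb{R}_+\times\mathbb{R}_+\to\mathbb{R}_+$ be the unique continuous function satisfying $\beta(y,0)=y$ and $\partial_t\beta(y,t)=\rho(\beta(y,t))$ for all $y,t\ge0$. If there exists a continuous function $V:G\to\mathbb{R}_+$ which satisfies $$\alpha_1(x)\le V(x)\le\alpha_2(x),\qquad \dot V(x)\le\rho(V(x)),\qquad\forall x\in G,$$ where $\dot V(x):=D_t^+V(\phi_f(x,t))|_{t=0}$, then $f$ is $\beta$-stable on $G$ with respect to $\alpha_1,\alpha_2$, i.e. $\alpha_1(\phi_f(x,t))\le\beta(\alpha_2(x),t)$ for all $x\in G$ and $t\ge0$.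
   Context: $\mathbb{R}_+=[0,\infty)$. For $f:\Omega\to\mathbb{R}^n$, $\phi_f$ denotes the solution map of the ODE: $\partial_t\phi_f(x,t)=f(\phi_f(x,t))$, $\phi_f(x,0)=x$. Standing assumption: $\phi_f$ is well-defined, unique (for finite-time stable systems, uniqueness may be relaxed at the origin only), jointly continuous in $(x,t)$, and satisfies $\phi_f(\phi_f(x,t),s)=\phi_f(x,t+s)$ for $t,s\ge0$. $G\subseteq\Omega$ is forward invariant for $f$ if $\phi_f(x,t)\in G$ for all $x\in G$, $t\ge 0$. $D_t^+v(t)=\limsup_{h\to0^+}\frac{v(t+h)-v(t)}{h}$ is the upper right-hand Dini derivative. "The unique continuous function satisfying ..." means that it is assumed that exactly one continuous $\beta$ with the stated properties exists. *)

theory Defs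
  imports "HOL-Analysis.Analysis"
begin

definition solves_ode_on ::
  "(real ^ 'n \<Rightarrow> real ^ 'n) \<Rightarrow> (real ^ 'n) set \<Rightarrow> real set \<Rightarrow> real ^ 'n \<Rightarrow> (real \<Rightarrow> real ^ 'n) \<Rightarrow> bool"
where
  "solves_ode_on f \<Omega> I x u \<longleftrightarrow>
     u 0 = x \<and>
     (\<forall>t\<in>I. u t \<in> \<Omega> \<and> (u has_vector_derivative f (u t)) (at t within I))"

text \<open>
  Uniqueness is only demanded up to the first time a solution visits the origin, so that
  finite-time stable systems (which may lose uniqueness there) are covered as well.  Ordinary
  uniqueness of forward solutions implies this condition.
\<close>

definition solution_map ::
  "(real ^ 'n) set \<Rightarrow> (real ^ 'n \<Rightarrow> real ^ 'n) \<Rightarrow> (real ^ 'n \<Rightarrow> real \<Rightarrow> real ^ 'n) \<Rightarrow> bool"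
where
  "solution_map \<Omega> f \<phi> \<longleftrightarrow>
     (\<forall>x\<in>\<Omega>. solves_ode_on f \<Omega> {0..} x (\<phi> x)) \<and>
     (\<forall>x\<in>\<Omega>. \<forall>T>0. \<forall>u. solves_ode_on f \<Omega> {0..<T} x u \<longrightarrow>
        (\<forall>t\<in>{0..<T}. (\<forall>s\<in>{0..<t}. u s \<noteq> 0) \<longrightarrow> u t = \<phi> x t)) \<and>
     continuous_on (\<Omega> \<times> {0..}) (\<lambda>(x, t). \<phi> x t) \<and>
     (\<forall>x\<in>\<Omega>. \<forall>t\<ge>0. \<forall>s\<ge>0. \<phi> (\<phi> x t) s = \<phi> x (t + s))"

definition forward_invariant ::
  "(real ^ 'n \<Rightarrow> real \<Rightarrow> real ^ 'n) \<Rightarrow> (real ^ 'n) set \<Rightarrow> bool"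
where
  "forward_invariant \<phi> G \<longleftrightarrow> (\<forall>x\<in>G. \<forall>t\<ge>0. \<phi> x t \<in> G)"

text \<open>The limit superior is taken in the extended reals, since it may be infinite.\<close>

definition upper_right_Dini :: "(real \<Rightarrow> real) \<Rightarrow> real \<Rightarrow> ereal" where
  "upper_right_Dini v t = Limsup (at_right 0) (\<lambda>h. ereal ((v (t + h) - v t) / h))"

definition orbital_derivative ::
  "(real ^ 'n \<Rightarrow> real \<Rightarrow> real ^ 'n) \<Rightarrow> (real ^ 'n \<Rightarrow> real) \<Rightarrow> real ^ 'n \<Rightarrow> ereal"
where
  "orbital_derivative \<phi> V x = upper_right_Dini (\<lambda>t. V (\<phi> x t)) 0"

definition scalar_flow :: "(real \<Rightarrow> real) \<Rightarrow> (real \<Rightarrow> real \<Rightarrow> real) \<Rightarrow> bool" where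
  "scalar_flow \<rho> \<beta> \<longleftrightarrow>
     continuous_on ({0..} \<times> {0..}) (\<lambda>(y, t). \<beta> y t) \<and>
     (\<forall>y\<ge>0. \<forall>t\<ge>0. \<beta> y t \<ge> 0) \<and>
     (\<forall>y\<ge>0. \<beta> y 0 = y) \<and>
     (\<forall>y\<ge>0. \<forall>t\<ge>0. (\<beta> y has_real_derivative \<rho> (\<beta> y t)) (at t within {0..}))"

text \<open>
  Uniqueness is among functions on pairs of nonnegative reals; values elsewhere are irrelevant.
\<close>

definition unique_scalar_flow :: "(real \<Rightarrow> real) \<Rightarrow> (real \<Rightarrow> real \<Rightarrow> real) \<Rightarrow> bool" where
  "unique_scalar_flow \<rho> \<beta> \<longleftrightarrow>
     scalar_flow \<rho> \<beta> \<and>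
     (\<forall>\<gamma>. scalar_flow \<rho> \<gamma> \<longrightarrow> (\<forall>y\<ge>0. \<forall>t\<ge>0. \<gamma> y t = \<beta> y t))"

definition beta_stable ::
  "(real ^ 'n \<Rightarrow> real \<Rightarrow> real ^ 'n) \<Rightarrow> (real \<Rightarrow> real \<Rightarrow> real) \<Rightarrow> (real ^ 'n) set
     \<Rightarrow> (real ^ 'n \<Rightarrow> real) \<Rightarrow> (real ^ 'n \<Rightarrow> real) \<Rightarrow> bool"
where
  "beta_stable \<phi> \<beta> G \<alpha>\<^sub>1 \<alpha>\<^sub>2 \<longleftrightarrow> (\<forall>x\<in>G. \<forall>t\<ge>0. \<alpha>\<^sub>1 (\<phi> x t) \<le> \<beta> (\<alpha>\<^sub>2 x) t)"

end

theory Submission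
  imports Defs
begin

text \<open>
  Along a trajectory of the system the Lyapunov function is a continuous \<open>v \<ge> 0\<close> with
  \<open>D\<^sup>+ v \<le> \<rho>(v)\<close>.  The theorem follows once \<open>v(t) \<le> \<beta>(v(0), t)\<close> is known, because \<open>\<beta>\<close> is
  monotone in its first argument.  The difficulty is that \<open>\<rho>\<close> is an arbitrary function, not even
  continuous, so that the classical comparison theorem does not apply: a solution of
  \<open>y' = \<rho>(y)\<close> need not be unique, and \<open>\<beta>(\<cdot>, t)\<close> need not be Lipschitz.  All regularity has to be
  extracted from the assumption that \<open>\<beta>\<close> is the only jointly continuous family of solutions.
  Every construction of a second such family gives a property of \<open>\<beta>\<close>.

  Restarting at time \<open>s\<close> from the value \<open>\<beta>(y, s)\<close> gives another family, so \<open>\<beta>\<close> is a semiflow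
  (\<open>flow_flow\<close>).  Hence trajectories that meet stay together, \<open>\<beta>\<close> is monotone in \<open>y\<close>, and each
  trajectory is monotone in time (\<open>flow_monotone\<close>).

  Suppose \<open>c > 0\<close> and \<open>\<rho>(c) = 0\<close>, but the trajectory of \<open>c\<close> leaves \<open>c\<close>, say downwards.  By
  continuity the trajectories that start slightly above \<open>c\<close> pass through \<open>c\<close>.  They could as well
  rest there for a time \<open>y - c\<close> before they go on: as \<open>\<rho>(c) = 0\<close>, the modified trajectories
  still solve the equation, and they depend continuously on \<open>y\<close> because the delay vanishes at
  \<open>y = c\<close>.  This contradicts uniqueness, so every positive zero of \<open>\<rho>\<close> is an equilibrium
  (\<open>critical_imp_equilibrium\<close>).  Only the level \<open>0\<close>, which has no levels on its other side, can
  be left with zero speed, as in \<open>\<beta>(y, t) = (y\<^sup>1\<^sup>/\<^sup>3 + t)\<^sup>3\<close>.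

  On an interval where \<open>\<rho>(v) \<noteq> 0\<close>, the function \<open>F(\<tau>) = \<beta>(v(\<tau>), t - \<tau>)\<close> cannot increase.  A
  Lipschitz bound in \<open>y\<close> is replaced by a time shift: \<open>v(\<tau> + h) \<le> \<beta>(v(\<tau>), (1 + \<kappa>) h)\<close> for a small
  \<open>\<kappa>\<close> with the sign of \<open>\<rho>(v(\<tau>))\<close>, hence \<open>F(\<tau> + h) \<le> \<beta>(v(\<tau>), t - \<tau> + \<kappa> h)\<close>, and \<open>\<beta>\<close> is
  differentiable in time (\<open>compare_noncritical\<close>).  Visits of \<open>v\<close> to the level \<open>0\<close> are harmless
  because \<open>\<beta> \<ge> 0\<close> (\<open>compare_nonequilibrium\<close>).  Finally \<open>v\<close> never rises above an equilibrium it has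
  attained (\<open>equilibrium_is_barrier\<close>), so that the comparison up to the first visit of an
  equilibrium extends to all later times (\<open>compare\<close>).
\<close>

section \<open>Tools from real analysis\<close>

lemma DERIV_within_glue:
  fixes f :: "real \<Rightarrow> real"
  assumes "(f has_real_derivative D) (at x within S)"
    and "(f has_real_derivative D) (at x within T)"
  shows "(f has_real_derivative D) (at x within (S \<union> T))"
  using assms unfolding has_field_derivative_iff by (simp add: Lim_within_Un)

text \<open>
  Truncating \<open>g\<close> at the level \<open>c\<close> creates no kink where \<open>g\<close> reaches \<open>c\<close> with speed \<open>0\<close>.
\<close>

lemma DERIV_max_const:
  fixes g :: "real \<Rightarrow> real"
  assumes cont: "continuous (at t within S) g"
    and deriv: "g t \<ge> c \<Longrightarrow> (g has_real_derivative D) (at t within S)"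
    and crit: "g t = c \<Longrightarrow> D = 0"
  shows "((\<lambda>s. max (g s) c) has_real_derivative (if g t > c then D else 0)) (at t within S)"
proof -
  have tend: "(g \<longlongrightarrow> g t) (at t within S)"
    using cont by (simp add: continuous_within)
  consider "g t > c" | "g t < c" | "g t = c" by linarith
  then show ?thesis
  proof cases
    case 1
    have "\<forall>\<^sub>F s in at t within S. max (g s) c = g s"
      using order_tendstoD(1)[OF tend 1] by eventually_elim auto
    then show ?thesis
      using 1 deriv has_field_derivative_cong_eventually[of "\<lambda>s. max (g s) c" g t S D] by auto
  next
    case 2
    have "\<forall>\<^sub>F s in at t within S. max (g s) c = c"
      using order_tendstoD(2)[OF tend 2] by eventually_elim auto
    then show ?thesis
      using 2 has_field_derivative_cong_eventually[of "\<lambda>s. max (g s) c" "\<lambda>_. c" t S 0] by auto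
  next
    case 3
    have "((\<lambda>s. (g s - g t) / (s - t)) \<longlongrightarrow> 0) (at t within S)"
      using deriv crit 3 by (auto simp: has_field_derivative_iff)
    then have "((\<lambda>s. norm ((g s - g t) / (s - t))) \<longlongrightarrow> 0) (at t within S)"
      using tendsto_norm_zero by blast
    then have "((\<lambda>s. (max (g s) c - max (g t) c) / (s - t)) \<longlongrightarrow> 0) (at t within S)"
      by (rule Lim_null_comparison[rotated])
        (auto intro!: always_eventually divide_right_mono simp: 3 abs_divide)
    then show ?thesis
      using 3 by (simp add: has_field_derivative_iff)
  qed
qed

lemma DERIV_min_const:
  fixes g :: "real \<Rightarrow> real"
  assumes "continuous (at t within S) g"
    and "g t \<le> c \<Longrightarrow> (g has_real_derivative D) (at t within S)"
    and "g t = c \<Longrightarrow> D = 0"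
  shows "((\<lambda>s. min (g s) c) has_real_derivative (if g t < c then D else 0)) (at t within S)"
proof -
  have "((\<lambda>s. max (- g s) (- c)) has_real_derivative (if - g t > - c then - D else 0)) (at t within S)"
    using assms by (intro DERIV_max_const) (auto intro: continuous_minus DERIV_minus)
  then have "((\<lambda>s. - max (- g s) (- c)) has_real_derivative - (if - g t > - c then - D else 0))
      (at t within S)"
    by (rule DERIV_minus)
  moreover have "(\<lambda>s. - max (- g s) (- c)) = (\<lambda>s. min (g s) c)"
    by (auto simp: min_def max_def)
  ultimately show ?thesis
    by (simp split: if_splits)
qed

lemma first_time:
  fixes g :: "real \<Rightarrow> real"
  assumes cont: "continuous_on {a..b} g" and "closed C" and "t \<in> {a..b}" "g t \<in> C"
  obtains \<tau> where "\<tau> \<in> {a..b}" "g \<tau> \<in> C" "\<And>s. s \<in> {a..<\<tau>} \<Longrightarrow> g s \<notin> C"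
proof -
  define K where "K = {a..b} \<inter> g -` C"
  have "closed K"
    unfolding K_def using cont \<open>closed C\<close> by (intro continuous_closed_preimage) auto
  then have "compact K"
    using compact_Int_closed[of "{a..b}" K] by (simp add: K_def Int_assoc[symmetric])
  moreover have "K \<noteq> {}" using assms by (auto simp: K_def)
  ultimately obtain \<tau> where \<tau>: "\<tau> \<in> K" and extremal: "\<And>s. s \<in> K \<Longrightarrow> \<tau> \<le> s"
    using compact_attains_inf[of K] by blast
  show ?thesis
  proof (rule that)
    show "g s \<notin> C" if "s \<in> {a..<\<tau>}" for s
      using extremal[of s] that \<tau> by (auto simp: K_def)
  qed (use \<tau> in \<open>auto simp: K_def\<close>)
qed

lemma last_time:
  fixes g :: "real \<Rightarrow> real"
  assumes cont: "continuous_on {a..b} g" and "closed C" and "t \<in> {a..b}" "g t \<in> C"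
  obtains \<tau> where "\<tau> \<in> {a..b}" "g \<tau> \<in> C" "\<And>s. s \<in> {\<tau><..b} \<Longrightarrow> g s \<notin> C"
proof -
  define K where "K = {a..b} \<inter> g -` C"
  have "closed K"
    unfolding K_def using cont \<open>closed C\<close> by (intro continuous_closed_preimage) auto
  then have "compact K"
    using compact_Int_closed[of "{a..b}" K] by (simp add: K_def Int_assoc[symmetric])
  moreover have "K \<noteq> {}" using assms by (auto simp: K_def)
  ultimately obtain \<tau> where \<tau>: "\<tau> \<in> K" and extremal: "\<And>s. s \<in> K \<Longrightarrow> s \<le> \<tau>"
    using compact_attains_sup[of K] by blast
  show ?thesis
  proof (rule that)
    show "g s \<notin> C" if "s \<in> {\<tau><..b}" for s
      using extremal[of s] that \<tau> by (auto simp: K_def)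
  qed (use \<tau> in \<open>auto simp: K_def\<close>)
qed

lemma upcrossing:
  fixes g :: "real \<Rightarrow> real"
  assumes "a \<le> b" and cont: "continuous_on {a..b} g" and "g a \<le> p" "p < q" "q \<le> g b"
  obtains s t where "a \<le> s" "s < t" "t \<le> b" "g s = p" "g t = q"
    "\<And>r. s < r \<Longrightarrow> r < t \<Longrightarrow> p < g r \<and> g r < q"
proof -
  obtain t where t: "t \<in> {a..b}" "g t \<ge> q" and below: "\<And>r. r \<in> {a..<t} \<Longrightarrow> g r < q"
    using first_time[OF cont closed_atLeast[of q], of b] assms by (auto simp: not_le)
  have cont': "continuous_on {a..t} g"
    by (rule continuous_on_subset[OF cont]) (use t in auto)
  obtain s where s: "s \<in> {a..t}" "g s \<le> p" and above: "\<And>r. r \<in> {s<..t} \<Longrightarrow> p < g r"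
    using last_time[OF cont' closed_atMost[of p], of a] assms t by (auto simp: not_le)
  have "g t = q"
  proof (rule ccontr)
    assume "g t \<noteq> q"
    then obtain r where "a \<le> r" "r \<le> t" "g r = q"
      using IVT'[of g a q t] cont' assms t by auto
    with below[of r] \<open>g t \<noteq> q\<close> show False by (cases "r = t") auto
  qed
  moreover have "s < t" using s t \<open>p < q\<close> by (cases "s = t") auto
  moreover have "g s = p"
  proof (rule ccontr)
    assume "g s \<noteq> p"
    moreover obtain r where "s \<le> r" "r \<le> t" "g r = p"
      using IVT'[of g s p t] continuous_on_subset[OF cont', of "{s..t}"] s t \<open>p < q\<close> by auto
    ultimately show False using above[of r] by (cases "r = s") auto
  qed
  ultimately show ?thesis
    using that[of s t] s t above below by auto
qed

text \<open>
  A substitute for the mean value theorem for functions without derivatives: subtract from \<open>g\<close> a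
  line of half its mean slope \<open>\<epsilon>\<close> and take the last time at which the difference is at most its
  initial value.
\<close>

lemma steep_point:
  fixes g :: "real \<Rightarrow> real"
  assumes "a < b" and cont: "continuous_on {a..b} g" and less: "g a < g b"
  obtains \<tau> \<epsilon> where "a \<le> \<tau>" "\<tau> < b" "g a \<le> g \<tau>" "g \<tau> < g b" "\<epsilon> > 0"
    "\<And>h. 0 < h \<Longrightarrow> \<tau> + h \<le> b \<Longrightarrow> g (\<tau> + h) > g \<tau> + \<epsilon> * h"
proof -
  define \<epsilon> where "\<epsilon> = (g b - g a) / (2 * (b - a))"
  define G where "G t = g t - \<epsilon> * (t - a)" for t
  have \<epsilon>: "\<epsilon> > 0" "\<epsilon> * (b - a) = (g b - g a) / 2"
    using assms by (auto simp: \<epsilon>_def field_simps)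
  have contG: "continuous_on {a..b} G"
    unfolding G_def by (intro continuous_intros cont)
  have Gb: "G b > G a" using less \<epsilon>(2) by (simp add: G_def)
  obtain \<tau> where \<tau>: "\<tau> \<in> {a..b}" "G \<tau> \<le> G a" and above: "\<And>t. t \<in> {\<tau><..b} \<Longrightarrow> G t > G a"
    using last_time[OF contG closed_atMost[of "G a"], of a] \<open>a < b\<close> by (auto simp: not_le)
  have "\<tau> < b" using Gb \<tau> by (cases "\<tau> = b") auto
  have eq: "G \<tau> = G a"
  proof (rule ccontr)
    assume "G \<tau> \<noteq> G a"
    moreover obtain t where "\<tau> \<le> t" "t \<le> b" "G t = G a"
      using IVT'[of G \<tau> "G a" b] continuous_on_subset[OF contG, of "{\<tau>..b}"] \<tau> Gb by auto
    ultimately show False using above[of t] by (cases "t = \<tau>") auto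
  qed
  have "\<epsilon> * (\<tau> - a) \<ge> 0" "\<epsilon> * (\<tau> - a) < \<epsilon> * (b - a)"
    using \<epsilon>(1) \<tau> \<open>\<tau> < b\<close> by auto
  then have "g a \<le> g \<tau>" "g \<tau> < g b"
    using eq \<epsilon>(2) less by (auto simp: G_def)
  moreover have "g (\<tau> + h) > g \<tau> + \<epsilon> * h" if "0 < h" "\<tau> + h \<le> b" for h
    using above[of "\<tau> + h"] that eq by (simp add: G_def algebra_simps)
  ultimately show ?thesis
    using that \<tau> \<open>\<tau> < b\<close> \<epsilon>(1) by auto
qed

lemma upper_right_Dini_less:
  assumes "upper_right_Dini v t \<le> ereal r" and "r < q"
  shows "\<forall>\<^sub>F h in at_right 0. v (t + h) < v t + q * h"
proof -
  have "upper_right_Dini v t < ereal q"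
    using assms by (simp add: le_less_trans)
  then have "\<forall>\<^sub>F h in at_right 0. ereal ((v (t + h) - v t) / h) < ereal q"
    unfolding upper_right_Dini_def by (rule Limsup_lessD)
  moreover have "\<forall>\<^sub>F h in at_right 0. (0::real) < h"
    by (simp add: eventually_at_filter)
  ultimately show ?thesis
    by eventually_elim (simp add: field_simps)
qed

section \<open>Delaying a scalar trajectory at a critical level\<close>

text \<open>
  The function \<open>w\<close> follows \<open>u\<close> from above down to the critical level \<open>c\<close>, rests there for the time
  \<open>d\<close>, and then goes on below \<open>c\<close>.  Writing it as the part of \<open>u\<close> above \<open>c\<close> plus the part below \<open>c\<close>
  of the delayed trajectory avoids any mention of the time at which \<open>u\<close> reaches \<open>c\<close>, which need
  not exist.  This form also makes the joint continuity of a family of such functions evident.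
\<close>

lemma delayed_trajectory:
  fixes u r :: "real \<Rightarrow> real"
  assumes deriv: "\<And>t. t \<ge> 0 \<Longrightarrow> (u has_real_derivative r (u t)) (at t within {0..})"
    and monotone: "mono_on {0..} u \<or> antimono_on {0..} u"
    and d: "d = 0 \<or> d > 0 \<and> c < u 0" and crit: "r c = 0" and "t \<ge> 0"
  defines "w \<equiv> \<lambda>t. max (u t) c + min (u (max 0 (t - d))) c - c"
  shows "(w has_real_derivative r (w t)) (at t within {0..})"
proof -
  define B where "B = (\<lambda>t. u (max 0 (t - d)))"
  have contu: "continuous_on {0..} u"
    unfolding continuous_on_eq_continuous_within using deriv DERIV_continuous by blast
  have contB: "continuous_on {0..} B"
    unfolding B_def by (rule continuous_on_compose2[OF contu]) (auto intro!: continuous_intros)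
  \<comment> \<open>At the kink of the delayed function, at time \<open>d\<close>, its value is \<open>u 0 >
    c\<close>; there the truncation at \<open>c\<close> hides it.\<close>
  have derB: "(B has_real_derivative r (B t)) (at t within {0..})" if "B t \<le> c"
  proof (cases "d = 0")
    case True
    have "(B has_real_derivative r (u t)) (at t within {0..})"
      by (rule has_field_derivative_transform_within[OF deriv[OF \<open>t \<ge> 0\<close>], of 1])
        (use True \<open>t \<ge> 0\<close> in \<open>auto simp: B_def\<close>)
    then show ?thesis using True \<open>t \<ge> 0\<close> by (simp add: B_def)
  next
    case False
    with d that have "t > d" by (cases "t \<le> d") (auto simp: B_def)
    have "(u has_real_derivative r (u (t - d))) (at (t - d) within {0..})"
      using deriv \<open>t > d\<close> by auto
    then have "(u has_real_derivative r (u (t - d))) (at (t - d))"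
      using at_within_open_subset[of "t - d" "{0<..}" "{0..}"] \<open>t > d\<close>
      by (auto simp: subset_iff)
    then have "((\<lambda>s. u (s + - d)) has_real_derivative r (u (t - d))) (at t)"
      using DERIV_shift[of u "r (u (t - d))" t "- d"] by (metis add_uminus_conv_diff)
    then have "((\<lambda>s. u (s - d)) has_real_derivative r (u (t - d))) (at t)"
      by (simp only: add_uminus_conv_diff)
    then have "(B has_real_derivative r (u (t - d))) (at t)"
      by (rule has_field_derivative_transform_within_open[of _ _ _ "{d<..}"])
        (use \<open>t > d\<close> in \<open>auto simp: B_def\<close>)
    then show ?thesis
      using \<open>t > d\<close> by (simp add: B_def has_field_derivative_at_within)
  qed
  have "((\<lambda>s. max (u s) c + min (B s) c - c) has_real_derivative
      ((if u t > c then r (u t) else 0) + (if B t < c then r (B t) else 0) - 0)) (at t within {0..})"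
  proof (intro DERIV_diff DERIV_add DERIV_const)
    show "((\<lambda>s. max (u s) c) has_real_derivative (if u t > c then r (u t) else 0)) (at t within {0..})"
      using crit deriv[OF \<open>t \<ge> 0\<close>] by (intro DERIV_max_const DERIV_continuous) auto
    have "continuous (at t within {0..}) B"
      using contB \<open>t \<ge> 0\<close> by (simp add: continuous_on_eq_continuous_within)
    then show "((\<lambda>s. min (B s) c) has_real_derivative (if B t < c then r (B t) else 0)) (at t within {0..})"
      using crit derB by (intro DERIV_min_const) auto
  qed
  moreover have "(if u t > c then r (u t) else 0) + (if B t < c then r (B t) else 0) - 0 = r (w t)"
  proof -
    \<comment> \<open>This excludes that \<open>u\<close> is above and the delayed function below \<open>c\<close>,
      where two nonzero slopes would be added.\<close>
    have "u t \<le> B t \<or> c \<le> B t \<and> c \<le> u t"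
      using d
    proof
      assume "d = 0"
      then show ?thesis using \<open>t \<ge> 0\<close> by (simp add: B_def)
    next
      assume "d > 0 \<and> c < u 0"
      with monotone show ?thesis
      proof (elim disjE)
        assume mono: "mono_on {0..} u"
        have "u 0 \<le> u t" "u 0 \<le> u (max 0 (t - d))"
          by (rule mono_onD[OF mono]; use \<open>t \<ge> 0\<close> in simp)+
        with \<open>d > 0 \<and> c < u 0\<close> show ?thesis by (simp add: B_def)
      next
        assume anti: "antimono_on {0..} u"
        have "u t \<le> u (max 0 (t - d))"
          by (rule monotone_onD[OF anti]; use \<open>t \<ge> 0\<close> \<open>d > 0 \<and> c < u 0\<close> in simp)
        then show ?thesis by (simp add: B_def)
      qed
    qed
    then consider "c < u t" "c \<le> B t" | "u t \<le> c" "c \<le> B t" | "u t \<le> c" "B t < c"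
      by linarith
    then show ?thesis
    proof cases
      case 1
      then have "w t = u t" by (simp add: w_def B_def)
      then show ?thesis using 1 by simp
    next
      case 2
      then have "w t = c" by (simp add: w_def B_def)
      then show ?thesis using 2 crit by simp
    next
      case 3
      then have "w t = B t" by (simp add: w_def B_def)
      then show ?thesis using 3 by simp
    qed
  qed
  ultimately show ?thesis
    by (simp add: w_def B_def)
qed


section \<open>Scalar flows determined by uniqueness\<close>

locale unique_flow =
  fixes \<rho> :: "real \<Rightarrow> real" and \<beta> :: "real \<Rightarrow> real \<Rightarrow> real"
  assumes unique: "unique_scalar_flow \<rho> \<beta>"
begin

lemma flow_cont: "continuous_on ({0..} \<times> {0..}) (\<lambda>(y, t). \<beta> y t)"
  and flow_nonneg [simp]: "0 \<le> y \<Longrightarrow> 0 \<le> t \<Longrightarrow> 0 \<le> \<beta> y t"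
  and flow_0 [simp]: "0 \<le> y \<Longrightarrow> \<beta> y 0 = y"
  and flow_deriv: "0 \<le> y \<Longrightarrow> 0 \<le> t \<Longrightarrow> (\<beta> y has_real_derivative \<rho> (\<beta> y t)) (at t within {0..})"
  and flow_unique: "scalar_flow \<rho> \<gamma> \<Longrightarrow> 0 \<le> y \<Longrightarrow> 0 \<le> t \<Longrightarrow> \<gamma> y t = \<beta> y t"
  using unique unfolding unique_scalar_flow_def scalar_flow_def by auto

lemma continuous_on_flow [continuous_intros]:
  fixes p q :: "'c::topological_space \<Rightarrow> real"
  assumes "continuous_on S p" "continuous_on S q"
    and "\<And>x. x \<in> S \<Longrightarrow> 0 \<le> p x" "\<And>x. x \<in> S \<Longrightarrow> 0 \<le> q x"
  shows "continuous_on S (\<lambda>x. \<beta> (p x) (q x))"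
  using continuous_on_compose2[OF flow_cont continuous_on_Pair[OF assms(1,2)]] assms(3,4)
  by (simp add: image_subset_iff)

text \<open>
  The family that is restarted at time \<open>s\<close> is continuous and solves the equation, since at time \<open>s\<close>
  both one-sided derivatives equal \<open>\<rho> (\<beta> y s)\<close>.  By uniqueness it is \<open>\<beta>\<close>.
\<close>

lemma flow_flow:
  assumes "0 \<le> y" "0 \<le> s" "0 \<le> t"
  shows "\<beta> (\<beta> y s) t = \<beta> y (s + t)"
proof -
  \<comment> \<open>The truncations express the restart without a case distinction, so continuity follows by
    composition.\<close>
  define \<gamma> where "\<gamma> y t = \<beta> (\<beta> y (min t s)) (max 0 (t - s))" for y t
  have before: "\<gamma> y t = \<beta> y t" if "0 \<le> y" "0 \<le> t" "t \<le> s" for y t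
    using that by (simp add: \<gamma>_def)
  have after: "\<gamma> y t = \<beta> (\<beta> y s) (t - s)" if "s \<le> t" for y t
    using that by (simp add: \<gamma>_def min_def)
  have "(\<gamma> y has_real_derivative \<rho> (\<gamma> y t)) (at t within {0..})" if "0 \<le> y" "0 \<le> t" for y t
  proof -
    have "(\<gamma> y has_real_derivative \<rho> (\<gamma> y t)) (at t within {0..s})"
    proof (cases "t \<le> s")
      case True
      have "(\<gamma> y has_real_derivative \<rho> (\<beta> y t)) (at t within {0..s})"
        by (rule has_field_derivative_transform_within[of "\<beta> y" _ _ _ 1])
          (use True that before in \<open>auto intro: DERIV_subset[OF flow_deriv]\<close>)
      then show ?thesis using True that before by simp
    next
      case False
      then have "at t within {0..s} = bot" by (simp add: at_within_eq_bot_iff)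
      then show ?thesis by (simp add: has_field_derivative_iff)
    qed
    moreover have "(\<gamma> y has_real_derivative \<rho> (\<gamma> y t)) (at t within {s..})"
    proof (cases "s \<le> t")
      case True
      have "(\<beta> (\<beta> y s) has_real_derivative \<rho> (\<beta> (\<beta> y s) (t - s))) (at (t - s) within {0..})"
        using True that assms by (intro flow_deriv) auto
      moreover have "(+) (- s) ` {s..} = {- s + s..}" by (rule image_add_atLeast)
      ultimately have "((\<lambda>r. \<beta> (\<beta> y s) (r - s)) has_real_derivative \<rho> (\<beta> (\<beta> y s) (t - s)))
          (at t within {s..})"
        using DERIV_at_within_shift[of "\<beta> (\<beta> y s)" _ "- s" t "{s..}"] by (simp del: add_uminus_conv_diff)
      then have "(\<gamma> y has_real_derivative \<rho> (\<beta> (\<beta> y s) (t - s))) (at t within {s..})"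
        by (rule has_field_derivative_transform_within[of _ _ _ _ 1]) (use True after in auto)
      then show ?thesis using True after by simp
    next
      case False
      then have "at t within {s..} = bot" by (simp add: at_within_eq_bot_iff)
      then show ?thesis by (simp add: has_field_derivative_iff)
    qed
    ultimately have "(\<gamma> y has_real_derivative \<rho> (\<gamma> y t)) (at t within ({0..s} \<union> {s..}))"
      by (rule DERIV_within_glue)
    moreover have "{0..s} \<union> {s..} = {0..}" using assms by auto
    ultimately show ?thesis by simp
  qed
  moreover have "continuous_on ({0..} \<times> {0..}) (\<lambda>(y, t). \<gamma> y t)"
    unfolding \<gamma>_def split_beta using assms by (intro continuous_intros) auto
  ultimately have "scalar_flow \<rho> \<gamma>"
    using assms by (auto simp: scalar_flow_def \<gamma>_def)
  from flow_unique[OF this, of y "s + t"] show ?thesis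
    using assms after[of "s + t" y] by simp
qed

text \<open>
  Two trajectories that change their order would meet, and by the semiflow property they coincide
  from then on.
\<close>

lemma flow_mono:
  assumes "0 \<le> y" "y \<le> z" "0 \<le> t"
  shows "\<beta> y t \<le> \<beta> z t"
proof (rule ccontr)
  assume "\<not> \<beta> y t \<le> \<beta> z t"
  moreover have "continuous_on {0..t} (\<lambda>\<tau>. \<beta> y \<tau> - \<beta> z \<tau>)"
    using assms by (intro continuous_intros) auto
  ultimately obtain \<tau> where \<tau>: "0 \<le> \<tau>" "\<tau> \<le> t" "\<beta> y \<tau> - \<beta> z \<tau> = 0"
    using IVT'[of "\<lambda>\<tau>. \<beta> y \<tau> - \<beta> z \<tau>" 0 0 t] assms by auto
  then have "\<beta> y t = \<beta> z t"
    using flow_flow[of y \<tau> "t - \<tau>"] flow_flow[of z \<tau> "t - \<tau>"] assms by simp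
  then show False using \<open>\<not> \<beta> y t \<le> \<beta> z t\<close> by simp
qed

lemma flow_iterates:
  assumes "0 \<le> y" "0 \<le> h"
  shows "y \<le> \<beta> y h \<Longrightarrow> \<beta> y h \<le> \<beta> y (real (Suc n) * h)"
    and "\<beta> y h \<le> y \<Longrightarrow> \<beta> y (real (Suc n) * h) \<le> \<beta> y h"
proof (induction n)
  case (Suc n)
  have eq: "\<beta> y (real (Suc (Suc n)) * h) = \<beta> (\<beta> y h) (real (Suc n) * h)"
    using assms flow_flow[of y h "real (Suc n) * h"] by (simp add: algebra_simps)
  { case 1
    then show ?case
      using Suc.IH(1) flow_mono[of y "\<beta> y h" "real (Suc n) * h"] assms unfolding eq by simp
  next
    case 2
    then show ?case
      using Suc.IH(2) flow_mono[of "\<beta> y h" y "real (Suc n) * h"] assms unfolding eq by simp }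
qed auto

text \<open>
  For every \<open>n\<close> the trajectory is also back at \<open>y\<close> after the time \<open>a / n\<close>: otherwise its iterates at
  that time step, which are monotone, could not return to \<open>y\<close> at time \<open>a\<close>.  So it is at \<open>y\<close> at a
  dense set of times.
\<close>

lemma recurrent_imp_equilibrium:
  assumes "0 \<le> y" "0 < a" "\<beta> y a = y" "0 \<le> t"
  shows "\<beta> y t = y"
proof (rule ccontr)
  assume "\<beta> y t \<noteq> y"
  have "continuous_on {0..} (\<beta> y)"
    using assms by (intro continuous_intros) auto
  then obtain \<delta> where "\<delta> > 0"
    and near: "\<And>s. 0 \<le> s \<Longrightarrow> dist s t < \<delta> \<Longrightarrow> dist (\<beta> y s) (\<beta> y t) < dist (\<beta> y t) y"
    using \<open>\<beta> y t \<noteq> y\<close> \<open>0 \<le> t\<close> unfolding continuous_on_iff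
    by (metis atLeast_iff zero_less_dist_iff)
  obtain n where n: "inverse (real (Suc n)) < \<delta> / a"
    using reals_Archimedean[of "\<delta> / a"] \<open>\<delta> > 0\<close> \<open>0 < a\<close> by auto
  define h where "h = a / real (Suc n)"
  have h: "0 < h" "h < \<delta>" "real (Suc n) * h = a"
    using n \<open>0 < a\<close> by (auto simp: h_def field_simps)
  have fixed: "\<beta> y h = y"
    using flow_iterates[of y h n] assms(1,3) h by (metis antisym linear less_imp_le)
  have multiples: "\<beta> y (real k * h) = y" for k
  proof (induction k)
    case (Suc k)
    then show ?case
      using flow_flow[of y h "real k * h"] fixed assms h by (simp add: algebra_simps)
  qed (use assms in simp)
  define k where "k = nat \<lfloor>t / h\<rfloor>"
  have "real k \<le> t / h" "t / h < real k + 1"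
    using \<open>0 \<le> t\<close> h by (auto simp: k_def)
  then have "real k * h \<le> t" "t < real k * h + h"
    using h by (auto simp: field_simps)
  then have "dist (real k * h) t < \<delta>" using h by (simp add: dist_real_def)
  from near[OF _ this] multiples[of k] h show False by (simp add: dist_commute)
qed

text \<open>
  A trajectory that takes values on both sides of \<open>y\<close> returns to \<open>y\<close> and is thus constant.
  Otherwise \<open>y\<close> and all \<open>\<beta> y h\<close> are in a fixed order, which the monotone maps \<open>\<lambda>x. \<beta> x s\<close> carry to
  all later times.
\<close>

lemma flow_monotone:
  assumes "0 \<le> y"
  shows "mono_on {0..} (\<beta> y) \<or> antimono_on {0..} (\<beta> y)"
proof -
  have split: "\<beta> y t = \<beta> (\<beta> y (t - s)) s" if "0 \<le> s" "s \<le> t" for s t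
    using flow_flow[of y "t - s" s] assms that by simp
  have "(\<forall>h\<ge>0. y \<le> \<beta> y h) \<or> (\<forall>h\<ge>0. \<beta> y h \<le> y)"
  proof (rule ccontr)
    assume "\<not> ?thesis"
    then obtain h1 h2 where h: "h1 \<ge> 0" "\<beta> y h1 < y" "h2 \<ge> 0" "\<beta> y h2 > y"
      by (auto simp: not_le)
    have "h1 > 0" "h2 > 0" using h assms by (auto simp: less_le)
    have "connected (\<beta> y ` {0<..})"
      using assms by (intro connected_continuous_image continuous_intros) auto
    then have "y \<in> \<beta> y ` {0<..}"
      using connectedD_interval[of "\<beta> y ` {0<..}" "\<beta> y h1" "\<beta> y h2" y] h \<open>h1 > 0\<close> \<open>h2 > 0\<close> by auto
    then obtain a where "a > 0" "\<beta> y a = y" by auto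
    then have "\<beta> y h1 = y" using recurrent_imp_equilibrium assms h by blast
    then show False using h by simp
  qed
  then show ?thesis
  proof
    assume 1: "\<forall>h\<ge>0. y \<le> \<beta> y h"
    have "mono_on {0..} (\<beta> y)"
    proof (rule mono_onI)
      show "\<beta> y r \<le> \<beta> y t" if "r \<in> {0..}" "t \<in> {0..}" "r \<le> t" for r t
        using flow_mono[of y "\<beta> y (t - r)" r] 1 split[of r t] assms that by simp
    qed
    then show ?thesis ..
  next
    assume 2: "\<forall>h\<ge>0. \<beta> y h \<le> y"
    have "antimono_on {0..} (\<beta> y)"
    proof (rule monotone_onI)
      show "\<beta> y t \<le> \<beta> y r" if "r \<in> {0..}" "t \<in> {0..}" "r \<le> t" for r t
        using flow_mono[of "\<beta> y (t - r)" y r] 2 split[of r t] assms that by simp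
    qed
    then show ?thesis ..
  qed
qed

text \<open>
  The sign \<open>\<sigma>\<close> treats both directions at once: \<open>\<sigma> = 1\<close> says that the trajectory of \<open>c\<close> does not
  go down, \<open>\<sigma> = -1\<close> that it does not go up.  If it did, delaying the trajectories that come from
  the other side of \<open>c\<close> by the distance of their starting points to \<open>c\<close> would give a second
  scalar flow.
\<close>

lemma critical_level_not_crossed:
  assumes \<sigma>: "\<sigma> = 1 \<or> \<sigma> = -1" and "0 < c" "\<rho> c = 0" "0 \<le> t"
  shows "\<sigma> * c \<le> \<sigma> * \<beta> c t"
proof (rule ccontr)
  assume less: "\<not> \<sigma> * c \<le> \<sigma> * \<beta> c t"
  define d where "d y = max 0 (\<sigma> * (y - c))" for y
  define \<gamma> where "\<gamma> y t = \<sigma> * (max (\<sigma> * \<beta> y t) (\<sigma> * c)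
      + min (\<sigma> * \<beta> y (max 0 (t - d y))) (\<sigma> * c) - \<sigma> * c)" for y t
  have \<sigma>\<sigma> [simp]: "\<sigma> * \<sigma> = 1" "\<sigma> * (\<sigma> * x) = x" for x using \<sigma> by auto
  have monotone: "mono_on {0..} (\<lambda>t. \<sigma> * \<beta> y t) \<or> antimono_on {0..} (\<lambda>t. \<sigma> * \<beta> y t)"
    if "0 \<le> y" for y
    using flow_monotone[OF that] \<sigma> by (auto simp: monotone_on_def)
  have "scalar_flow \<rho> \<gamma>"
    unfolding scalar_flow_def
  proof (intro conjI allI impI)
    show "continuous_on ({0..} \<times> {0..}) (\<lambda>(y, t). \<gamma> y t)"
      unfolding \<gamma>_def d_def split_beta by (intro continuous_intros) auto
  next
    fix y t :: real assume "0 \<le> y" "0 \<le> t"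
    then have "0 \<le> \<beta> y t" "0 \<le> \<beta> y (max 0 (t - d y))" by auto
    then show "0 \<le> \<gamma> y t"
      using \<sigma> \<open>0 < c\<close> unfolding \<gamma>_def by (auto simp: max_def min_def)
  next
    fix y :: real assume "0 \<le> y"
    moreover have "max 0 (0 - d y) = 0" by (simp add: d_def)
    ultimately show "\<gamma> y 0 = y" using \<sigma> by (auto simp: \<gamma>_def max_def min_def)
  next
    fix y t :: real assume "0 \<le> y" "0 \<le> t"
    have "((\<lambda>t. max (\<sigma> * \<beta> y t) (\<sigma> * c) + min (\<sigma> * \<beta> y (max 0 (t - d y))) (\<sigma> * c) - \<sigma> * c)
        has_real_derivative \<sigma> * \<rho> (\<sigma> * (max (\<sigma> * \<beta> y t) (\<sigma> * c)
          + min (\<sigma> * \<beta> y (max 0 (t - d y))) (\<sigma> * c) - \<sigma> * c))) (at t within {0..})"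
    proof (rule delayed_trajectory[where r = "\<lambda>x. \<sigma> * \<rho> (\<sigma> * x)"])
      show "((\<lambda>t. \<sigma> * \<beta> y t) has_real_derivative \<sigma> * \<rho> (\<sigma> * (\<sigma> * \<beta> y t))) (at t within {0..})"
        if "0 \<le> t" for t
        using flow_deriv[OF \<open>0 \<le> y\<close> that] by (auto intro: DERIV_cmult)
    qed (use \<open>0 \<le> y\<close> \<open>0 \<le> t\<close> \<open>\<rho> c = 0\<close> monotone in \<open>auto simp: d_def max_def algebra_simps\<close>)
    from DERIV_cmult[OF this, of \<sigma>]
    show "(\<gamma> y has_real_derivative \<rho> (\<gamma> y t)) (at t within {0..})"
      unfolding \<gamma>_def by simp
  qed
  then have same: "\<gamma> y s = \<beta> y s" if "0 \<le> y" "0 \<le> s" for y s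
    using flow_unique that by blast
  have "continuous_on {0..} (\<lambda>y. \<sigma> * \<beta> y t)"
    using \<open>0 \<le> t\<close> by (intro continuous_intros) auto
  then obtain \<delta> where "\<delta> > 0" and near:
    "\<And>y. 0 \<le> y \<Longrightarrow> dist y c < \<delta> \<Longrightarrow> dist (\<sigma> * \<beta> y t) (\<sigma> * \<beta> c t) < \<sigma> * c - \<sigma> * \<beta> c t"
    using less \<open>0 < c\<close> unfolding continuous_on_iff
    by (metis atLeast_iff less_le not_le diff_gt_0_iff_gt)
  \<comment> \<open>A starting point close enough to \<open>c\<close> to pass through \<open>c\<close> before time
    \<open>t\<close>; positivity of \<open>c\<close> provides it also for \<open>\<sigma> = -1\<close>.\<close>
  define y where "y = c + \<sigma> * min (\<delta> / 2) (c / 2)"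
  have y: "0 \<le> y" "dist y c < \<delta>" "\<sigma> * c < \<sigma> * y"
    using \<sigma> \<open>\<delta> > 0\<close> \<open>0 < c\<close> by (auto simp: y_def dist_real_def min_def field_simps)
  have end_below: "\<sigma> * \<beta> y t < \<sigma> * c"
    using near[OF y(1,2)] by (simp add: dist_real_def abs_less_iff)
  have contu: "continuous_on {0..t} (\<lambda>s. \<sigma> * \<beta> y s)"
    using y by (intro continuous_intros) auto
  obtain T where T: "T \<in> {0..t}" "\<sigma> * c \<le> \<sigma> * \<beta> y T"
    and below: "\<And>s. s \<in> {T<..t} \<Longrightarrow> \<sigma> * \<beta> y s < \<sigma> * c"
    using last_time[OF contu closed_atLeast[of "\<sigma> * c"], of 0] y \<open>0 \<le> t\<close> by (auto simp: not_le)
  have "T < t" using T end_below by (cases "T = t") auto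
  have anti: "antimono_on {0..} (\<lambda>s. \<sigma> * \<beta> y s)"
    using monotone[OF y(1)] mono_onD[of "{0..}" "\<lambda>s. \<sigma> * \<beta> y s" 0 t] y end_below \<open>0 \<le> t\<close> by force
  \<comment> \<open>A time during the rest of the delayed trajectory at \<open>c\<close>, when \<open>\<beta>
    y\<close> is already beyond \<open>c\<close>.\<close>
  define s where "s = min t (T + d y)"
  have "d y > 0" using y by (auto simp: d_def algebra_simps)
  then have s: "T < s" "s \<le> t" "max 0 (s - d y) \<le> T"
    using \<open>T < t\<close> T by (auto simp: s_def)
  have "\<sigma> * c \<le> \<sigma> * \<beta> y (max 0 (s - d y))"
    using monotone_onD[OF anti, of "max 0 (s - d y)" T] T s by auto
  then have "\<gamma> y s = c"
    using below[of s] s by (simp add: \<gamma>_def)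
  moreover have "\<gamma> y s = \<beta> y s"
    by (rule same) (use y s T in auto)
  moreover have "\<sigma> * \<beta> y s < \<sigma> * c"
    by (rule below) (use s in auto)
  ultimately show False by simp
qed

lemma critical_imp_equilibrium:
  assumes "0 < c" "\<rho> c = 0" "0 \<le> t"
  shows "\<beta> c t = c"
  using critical_level_not_crossed[of 1 c t] critical_level_not_crossed[of "-1" c t] assms by simp

definition equilibria :: "real set" where
  "equilibria = {y. 0 \<le> y \<and> (\<forall>t\<ge>0. \<beta> y t = y)}"

lemma equilibrium_imp_critical:
  assumes "y \<in> equilibria"
  shows "\<rho> y = 0"
proof -
  have y: "0 \<le> y" "\<And>t. 0 \<le> t \<Longrightarrow> \<beta> y t = y"
    using assms by (auto simp: equilibria_def)
  then have "((\<lambda>t. (\<beta> y t - y) / t) \<longlongrightarrow> \<rho> y) (at_right 0)"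
    using DERIV_subset[OF flow_deriv[of y 0], of "{0<..}"]
    by (auto simp: has_field_derivative_iff subset_iff)
  moreover have "((\<lambda>t. (\<beta> y t - y) / t) \<longlongrightarrow> 0) (at_right 0)"
    by (rule tendsto_eventually) (use y in \<open>auto simp: eventually_at_filter\<close>)
  ultimately show ?thesis
    by (rule tendsto_unique[OF trivial_limit_at_right_real])
qed

lemma closed_equilibria: "closed equilibria"
proof -
  have "closed {y \<in> {0..}. \<beta> y t - y = 0}" if "0 \<le> t" for t
    using that by (intro continuous_closed_preimage_constant continuous_intros) auto
  then have "closed ({0..} \<inter> (\<Inter>t\<in>{0..}. {y \<in> {0..}. \<beta> y t - y = 0}))"
    by (intro closed_Int closed_INT ballI) auto
  moreover have "equilibria = {0..} \<inter> (\<Inter>t\<in>{0..}. {y \<in> {0..}. \<beta> y t - y = 0})"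
    by (auto simp: equilibria_def)
  ultimately show ?thesis by simp
qed

end

section \<open>Comparison of Dini subsolutions with the flow\<close>

locale flow_subsolution = unique_flow +
  fixes v :: "real \<Rightarrow> real"
  assumes v_cont: "continuous_on {0..} v"
    and v_nonneg [simp]: "0 \<le> t \<Longrightarrow> 0 \<le> v t"
    and v_Dini: "0 \<le> t \<Longrightarrow> upper_right_Dini v t \<le> ereal (\<rho> (v t))"
begin

lemma v_cont_Icc: "0 \<le> s \<Longrightarrow> continuous_on {s..t} v"
  by (rule continuous_on_subset[OF v_cont]) auto

lemma flow_along_cont:
  "0 \<le> s \<Longrightarrow> continuous_on {s..t} (\<lambda>\<tau>. \<beta> (v \<tau>) (t - \<tau>))"
  by (intro continuous_intros v_cont_Icc) auto

text \<open>
  The slope \<open>(1 + \<kappa>) * \<rho> (v \<tau>)\<close> of the right-hand side at \<open>h = 0\<close> is strictly larger than the Dini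
  derivative of \<open>v\<close>, whatever the sign of \<open>\<rho> (v \<tau>)\<close>.
\<close>

lemma short_time_bound:
  assumes "0 \<le> \<tau>" and \<kappa>: "0 < \<kappa> * \<rho> (v \<tau>)" "\<bar>\<kappa>\<bar> < 1"
  shows "\<forall>\<^sub>F h in at_right 0. v (\<tau> + h) \<le> \<beta> (v \<tau>) ((1 + \<kappa>) * h)"
proof -
  define w where "w = v \<tau>"
  have w: "0 \<le> w" using assms by (simp add: w_def)
  have "(\<beta> w has_real_derivative \<rho> w) (at 0 within {0..})"
    using flow_deriv[OF w, of 0] w by simp
  moreover have "(\<lambda>h. (1 + \<kappa>) * h) ` {0..} \<subseteq> {0..}"
    using \<kappa> by auto
  ultimately have "(\<beta> w has_real_derivative \<rho> w) (at ((1 + \<kappa>) * 0) within (\<lambda>h. (1 + \<kappa>) * h) ` {0..})"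
    by (auto intro: DERIV_subset)
  moreover have "((\<lambda>h. (1 + \<kappa>) * h) has_real_derivative (1 + \<kappa>)) (at 0 within {0..})"
    by (auto intro!: derivative_eq_intros)
  ultimately have "(\<beta> w \<circ> (\<lambda>h. (1 + \<kappa>) * h) has_real_derivative \<rho> w * (1 + \<kappa>)) (at 0 within {0..})"
    by (rule DERIV_image_chain)
  then have "((\<lambda>h. (\<beta> w ((1 + \<kappa>) * h) - w) / h) \<longlongrightarrow> \<rho> w * (1 + \<kappa>)) (at 0 within {0..})"
    using w by (simp add: has_field_derivative_iff)
  then have slope: "((\<lambda>h. (\<beta> w ((1 + \<kappa>) * h) - w) / h) \<longlongrightarrow> \<rho> w * (1 + \<kappa>)) (at_right 0)"
    by (rule tendsto_within_subset) auto
  have between: "\<rho> w < \<rho> w + \<kappa> * \<rho> w / 2" "\<rho> w + \<kappa> * \<rho> w / 2 < \<rho> w * (1 + \<kappa>)"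
    using \<kappa>(1) by (auto simp: w_def algebra_simps)
  have "\<forall>\<^sub>F h in at_right 0. \<rho> w + \<kappa> * \<rho> w / 2 < (\<beta> w ((1 + \<kappa>) * h) - w) / h"
    by (rule order_tendstoD(1)[OF slope between(2)])
  moreover have "\<forall>\<^sub>F h in at_right 0. v (\<tau> + h) < v \<tau> + (\<rho> w + \<kappa> * \<rho> w / 2) * h"
    using upper_right_Dini_less[OF v_Dini[OF \<open>0 \<le> \<tau>\<close>]] between(1) by (simp add: w_def)
  moreover have "\<forall>\<^sub>F h in at_right 0. (0::real) < h"
    by (simp add: eventually_at_filter)
  ultimately show ?thesis
  proof eventually_elim
    case (elim h)
    then have "(\<rho> w + \<kappa> * \<rho> w / 2) * h < \<beta> w ((1 + \<kappa>) * h) - w"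
      by (simp add: pos_less_divide_eq)
    with elim show ?case by (simp add: w_def)
  qed
qed

text \<open>
  If the claim fails, then \<open>\<lambda>\<tau>. \<beta> (v \<tau>) (t - \<tau>)\<close> has a point \<open>\<tau>\<close> with right slope at least some
  \<open>\<epsilon> > 0\<close>.  The bound on \<open>v\<close> for short times and the semiflow property turn an error in the first
  argument into a time shift by \<open>\<kappa> * h\<close>, so that this slope is at most \<open>\<kappa> * D\<close>, where \<open>D\<close> is the
  speed of \<open>\<beta> (v \<tau>)\<close> at time \<open>t - \<tau>\<close>.
\<close>

lemma compare_noncritical:
  assumes "0 \<le> s" "s \<le> t" and noncrit: "\<And>\<tau>. s \<le> \<tau> \<Longrightarrow> \<tau> < t \<Longrightarrow> \<rho> (v \<tau>) \<noteq> 0"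
  shows "v t \<le> \<beta> (v s) (t - s)"
proof (rule ccontr)
  assume "\<not> v t \<le> \<beta> (v s) (t - s)"
  then have less: "\<beta> (v s) (t - s) < \<beta> (v t) (t - t)" and "s < t"
    using assms by (auto simp: less_le)
  obtain \<tau> \<epsilon> where \<tau>: "s \<le> \<tau>" "\<tau> < t" and "0 < \<epsilon>" and
    steep: "\<And>h. 0 < h \<Longrightarrow> \<tau> + h \<le> t \<Longrightarrow>
      \<beta> (v \<tau>) (t - \<tau>) + \<epsilon> * h < \<beta> (v (\<tau> + h)) (t - (\<tau> + h))"
    using steep_point[OF \<open>s < t\<close> flow_along_cont[OF \<open>0 \<le> s\<close>] less] by metis
  define w D where "w = v \<tau>" and "D = \<rho> (\<beta> w (t - \<tau>))"
  have w: "0 \<le> w" "\<rho> w \<noteq> 0" using assms \<tau> by (auto simp: w_def)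
  \<comment> \<open>The size of \<open>\<kappa>\<close> is chosen such that \<open>\<bar>\<kappa> * D\<bar> <
    \<epsilon>\<close>.\<close>
  define \<kappa> where "\<kappa> = sgn (\<rho> w) * min (1 / 2) (\<epsilon> / (2 * (\<bar>D\<bar> + 1)))"
  have pos: "0 < min (1 / 2) (\<epsilon> / (2 * (\<bar>D\<bar> + 1)))" using \<open>0 < \<epsilon>\<close> by auto
  have abs_\<kappa>: "\<bar>\<kappa>\<bar> = min (1 / 2) (\<epsilon> / (2 * (\<bar>D\<bar> + 1)))"
    using pos w by (simp add: \<kappa>_def abs_mult abs_sgn_eq)
  have \<kappa>: "0 < \<kappa> * \<rho> w" "\<bar>\<kappa>\<bar> < 1"
  proof -
    have "\<kappa> * \<rho> w = min (1 / 2) (\<epsilon> / (2 * (\<bar>D\<bar> + 1))) * \<bar>\<rho> w\<bar>"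
      by (simp add: \<kappa>_def abs_sgn algebra_simps)
    then show "0 < \<kappa> * \<rho> w" using pos w by simp
    show "\<bar>\<kappa>\<bar> < 1" unfolding abs_\<kappa> by simp
  qed
  have "\<kappa> * D < \<epsilon>"
  proof -
    have "\<kappa> * D \<le> \<bar>\<kappa>\<bar> * \<bar>D\<bar>" by (metis abs_ge_self abs_mult)
    also have "\<dots> \<le> \<epsilon> / (2 * (\<bar>D\<bar> + 1)) * (\<bar>D\<bar> + 1)"
      unfolding abs_\<kappa> using \<open>0 < \<epsilon>\<close> by (intro mult_mono) auto
    also have "\<dots> = \<epsilon> / 2" by (simp add: field_simps add_eq_0_iff)
    finally show ?thesis using \<open>0 < \<epsilon>\<close> by simp
  qed
  have "(\<beta> w has_real_derivative D) (at (t - \<tau>) within {0..})"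
    unfolding D_def using w \<tau> by (intro flow_deriv) auto
  then have "(\<beta> w has_real_derivative D) (at (t - \<tau> + \<kappa> * 0))"
    using at_within_open_subset[of "t - \<tau>" "{0<..}" "{0..}"] \<tau> by (auto simp: subset_iff)
  moreover have "((\<lambda>h. t - \<tau> + \<kappa> * h) has_real_derivative \<kappa>) (at 0)"
    by (auto intro!: derivative_eq_intros)
  ultimately have "((\<lambda>h. \<beta> w (t - \<tau> + \<kappa> * h)) has_real_derivative D * \<kappa>) (at 0)"
    by (rule DERIV_chain2)
  then have "((\<lambda>h. (\<beta> w (t - \<tau> + \<kappa> * h) - \<beta> w (t - \<tau>)) / h) \<longlongrightarrow> D * \<kappa>) (at_right 0)"
    unfolding has_field_derivative_iff by (auto intro: tendsto_within_subset)
  then have "\<forall>\<^sub>F h in at_right 0. (\<beta> w (t - \<tau> + \<kappa> * h) - \<beta> w (t - \<tau>)) / h < \<epsilon>"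
    using \<open>\<kappa> * D < \<epsilon>\<close> by (auto intro: order_tendstoD simp: mult.commute)
  moreover have "\<forall>\<^sub>F h in at_right 0. v (\<tau> + h) \<le> \<beta> w ((1 + \<kappa>) * h)"
    unfolding w_def by (rule short_time_bound) (use assms \<tau> \<kappa> in \<open>auto simp: w_def\<close>)
  moreover have "\<forall>\<^sub>F h in at_right 0. 0 < h \<and> h < t - \<tau>"
    using \<tau> by (auto simp: eventually_at_right_field intro: exI[of _ "t - \<tau>"])
  ultimately have "\<forall>\<^sub>F h in at_right (0::real). False"
  proof eventually_elim
    case (elim h)
    have "0 \<le> (1 + \<kappa>) * h" using \<kappa> elim by auto
    have "\<beta> w (t - \<tau>) + \<epsilon> * h < \<beta> (v (\<tau> + h)) (t - (\<tau> + h))"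
      using steep[of h] elim by (simp add: w_def)
    also have "\<dots> \<le> \<beta> (\<beta> w ((1 + \<kappa>) * h)) (t - (\<tau> + h))"
      using elim assms \<tau> by (intro flow_mono) auto
    also have "\<dots> = \<beta> w (t - \<tau> + \<kappa> * h)"
      using flow_flow[of w "(1 + \<kappa>) * h" "t - (\<tau> + h)"] elim w \<open>0 \<le> (1 + \<kappa>) * h\<close>
      by (simp add: algebra_simps)
    finally show False using elim by (simp add: pos_divide_less_eq)
  qed
  then show False by simp
qed

text \<open>
  Positive levels that are not equilibria are noncritical.  The level \<open>v s\<close> itself may be critical,
  so the comparison starts at \<open>r > s\<close> and \<open>r\<close> tends to \<open>s\<close>.
\<close>

lemma compare_positive_nonequilibrium:
  assumes "0 \<le> s" "s \<le> t"
    and "\<And>\<tau>. s < \<tau> \<Longrightarrow> \<tau> < t \<Longrightarrow> v \<tau> \<noteq> 0 \<and> v \<tau> \<notin> equilibria"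
  shows "v t \<le> \<beta> (v s) (t - s)"
proof (cases "s = t")
  case True
  then show ?thesis using assms by simp
next
  case False
  then have "s < t" using assms by simp
  have "\<rho> (v \<tau>) \<noteq> 0" if "s < \<tau>" "\<tau> < t" for \<tau>
  proof
    assume "\<rho> (v \<tau>) = 0"
    moreover have "v \<tau> \<noteq> 0" "v \<tau> \<notin> equilibria" "0 \<le> v \<tau>" using assms that by auto
    ultimately show False
      using critical_imp_equilibrium[of "v \<tau>"] by (auto simp: equilibria_def less_le)
  qed
  then have "v t \<le> \<beta> (v r) (t - r)" if "s < r" "r < t" for r
    using that assms by (intro compare_noncritical) auto
  then have "\<forall>\<^sub>F r in at_right s. v t \<le> \<beta> (v r) (t - r)"
    using \<open>s < t\<close> by (auto simp: eventually_at_right_field)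
  moreover have "((\<lambda>r. \<beta> (v r) (t - r)) \<longlongrightarrow> \<beta> (v s) (t - s)) (at_right s)"
    using flow_along_cont[OF \<open>0 \<le> s\<close>, of t] \<open>s < t\<close>
    by (simp add: continuous_on_def at_within_Icc_at_right[OF \<open>s < t\<close>, symmetric])
  ultimately show ?thesis
    using tendsto_lowerbound trivial_limit_at_right_real by blast
qed

text \<open>
  The level \<open>0\<close> may be critical without being an equilibrium.  The comparison can be started afresh
  at the last time when \<open>v\<close> vanishes, since there the flow is at least \<open>0\<close>.
\<close>

lemma compare_nonequilibrium:
  assumes "0 \<le> s" "s \<le> t" and noneq: "\<And>\<tau>. s < \<tau> \<Longrightarrow> \<tau> < t \<Longrightarrow> v \<tau> \<notin> equilibria"
  shows "v t \<le> \<beta> (v s) (t - s)"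
proof (cases "\<exists>\<tau>\<in>{s..t}. v \<tau> = 0")
  case False
  then show ?thesis
    using assms by (intro compare_positive_nonequilibrium) auto
next
  case True
  then obtain r where r: "r \<in> {s..t}" "v r = 0" and pos: "\<And>\<tau>. \<tau> \<in> {r<..t} \<Longrightarrow> v \<tau> \<noteq> 0"
    using last_time[OF v_cont_Icc[OF \<open>0 \<le> s\<close>, of t] closed_singleton[of 0]] by (metis singletonI singletonD)
  have "v t \<le> \<beta> (v r) (t - r)"
    using r pos assms by (intro compare_positive_nonequilibrium) auto
  also have "\<dots> \<le> \<beta> (\<beta> (v s) (r - s)) (t - r)"
    using r assms by (intro flow_mono) auto
  also have "\<dots> = \<beta> (v s) (t - s)"
    using flow_flow[of "v s" "r - s" "t - r"] r assms by simp
  finally show ?thesis .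
qed

text \<open>
  If \<open>v\<close> rises above an equilibrium, it does so with positive slope at some point \<open>\<tau>\<close>, and \<open>v \<tau>\<close> is
  not an equilibrium.  Let \<open>e\<close> be the largest equilibrium below \<open>v \<tau>\<close>.  While \<open>v\<close> climbs from \<open>e\<close> to
  \<open>v \<tau>\<close> it meets no equilibrium, so the comparison on such intervals keeps it at \<open>e\<close>.
\<close>

lemma equilibrium_is_barrier:
  assumes "0 \<le> s" "s \<le> t" and eq: "v s \<in> equilibria"
  shows "v t \<le> v s"
proof (rule ccontr)
  assume "\<not> v t \<le> v s"
  then have "v s < v t" "s < t" using assms by (auto simp: less_le)
  obtain \<tau> \<epsilon> where \<tau>: "s \<le> \<tau>" "\<tau> < t" "v s \<le> v \<tau>" "0 < \<epsilon>" and
    steep: "\<And>h. 0 < h \<Longrightarrow> \<tau> + h \<le> t \<Longrightarrow> v \<tau> + \<epsilon> * h < v (\<tau> + h)"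
    using steep_point[OF \<open>s < t\<close> v_cont_Icc[OF \<open>0 \<le> s\<close>] \<open>v s < v t\<close>] by metis
  have "v \<tau> \<notin> equilibria"
  proof
    assume "v \<tau> \<in> equilibria"
    then have "\<rho> (v \<tau>) = 0" by (rule equilibrium_imp_critical)
    then have "\<forall>\<^sub>F h in at_right 0. v (\<tau> + h) < v \<tau> + \<epsilon> * h"
      using upper_right_Dini_less[OF v_Dini, of \<tau> \<epsilon>] \<tau> assms by simp
    moreover have "\<forall>\<^sub>F h in at_right 0. 0 < h \<and> h < t - \<tau>"
      using \<tau> by (auto simp: eventually_at_right_field intro: exI[of _ "t - \<tau>"])
    ultimately have "\<forall>\<^sub>F h in at_right (0::real). False"
      by eventually_elim (use steep in force)
    then show False by simp
  qed
  have "compact (equilibria \<inter> {v s..v \<tau>})"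
    using closed_equilibria compact_Icc by (rule closed_Int_compact)
  moreover have "v s \<in> equilibria \<inter> {v s..v \<tau>}" using eq \<tau> by auto
  ultimately obtain e where e: "e \<in> equilibria \<inter> {v s..v \<tau>}"
    and gap: "\<And>x. x \<in> equilibria \<inter> {v s..v \<tau>} \<Longrightarrow> x \<le> e"
    using compact_attains_sup[of "equilibria \<inter> {v s..v \<tau>}"] by blast
  have "e < v \<tau>" using e \<open>v \<tau> \<notin> equilibria\<close> by (auto simp: less_le)
  obtain p q where pq: "s \<le> p" "p < q" "q \<le> \<tau>" "v p = e" "v q = v \<tau>"
    and between: "\<And>r. p < r \<Longrightarrow> r < q \<Longrightarrow> e < v r \<and> v r < v \<tau>"
    using upcrossing[OF \<tau>(1) v_cont_Icc[OF \<open>0 \<le> s\<close>] _ \<open>e < v \<tau>\<close>] e by auto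
  have "v r \<notin> equilibria" if "p < r" "r < q" for r
    using gap[of "v r"] between[OF that] e by auto
  then have "v q \<le> \<beta> (v p) (q - p)"
    using pq assms by (intro compare_nonequilibrium) auto
  also have "\<dots> = e"
    using e pq by (auto simp: equilibria_def)
  finally show False using \<open>e < v \<tau>\<close> pq by simp
qed

lemma compare:
  assumes "0 \<le> t"
  shows "v t \<le> \<beta> (v 0) t"
proof (cases "\<exists>\<tau>\<in>{0..t}. v \<tau> \<in> equilibria")
  case False
  then show ?thesis
    using compare_nonequilibrium[of 0 t] assms by auto
next
  case True
  then obtain r where r: "r \<in> {0..t}" "v r \<in> equilibria"
    and before: "\<And>\<tau>. \<tau> \<in> {0..<r} \<Longrightarrow> v \<tau> \<notin> equilibria"
    using first_time[OF v_cont_Icc[of 0 t] closed_equilibria] by (metis order_refl)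
  have "v t \<le> v r"
    using r by (intro equilibrium_is_barrier) auto
  also have "\<dots> = \<beta> (v r) (t - r)"
    using r by (simp add: equilibria_def)
  also have "\<dots> \<le> \<beta> (\<beta> (v 0) (r - 0)) (t - r)"
    using r before by (intro flow_mono compare_nonequilibrium) auto
  also have "\<dots> = \<beta> (v 0) t"
    using flow_flow[of "v 0" r "t - r"] r by simp
  finally show ?thesis .
qed

end

section \<open>Stability from a Lyapunov function\<close>

theorem theorem15:
  fixes \<Omega> G :: "(real ^ 'n) set"
    and f :: "real ^ 'n \<Rightarrow> real ^ 'n"
    and \<phi> :: "real ^ 'n \<Rightarrow> real \<Rightarrow> real ^ 'n"
    and \<alpha>\<^sub>1 \<alpha>\<^sub>2 :: "real ^ 'n \<Rightarrow> real"
    and \<rho> :: "real \<Rightarrow> real"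
    and \<beta> :: "real \<Rightarrow> real \<Rightarrow> real"
  assumes "solution_map \<Omega> f \<phi>"
    and "G \<subseteq> \<Omega>" and "forward_invariant \<phi> G"
    and "continuous_on G \<alpha>\<^sub>1" and "\<forall>x\<in>G. \<alpha>\<^sub>1 x \<ge> 0"
    and "continuous_on G \<alpha>\<^sub>2" and "\<forall>x\<in>G. \<alpha>\<^sub>2 x \<ge> 0"
    and "unique_scalar_flow \<rho> \<beta>"
    and "\<exists>V :: real ^ 'n \<Rightarrow> real.
           continuous_on G V \<and> (\<forall>x\<in>G. V x \<ge> 0) \<and>
           (\<forall>x\<in>G. \<alpha>\<^sub>1 x \<le> V x \<and> V x \<le> \<alpha>\<^sub>2 x \<and>
                   orbital_derivative \<phi> V x \<le> ereal (\<rho> (V x)))"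
  shows "beta_stable \<phi> \<beta> G \<alpha>\<^sub>1 \<alpha>\<^sub>2"
proof -
  obtain V where V: "continuous_on G V" "\<And>x. x \<in> G \<Longrightarrow> 0 \<le> V x"
    "\<And>x. x \<in> G \<Longrightarrow> \<alpha>\<^sub>1 x \<le> V x" "\<And>x. x \<in> G \<Longrightarrow> V x \<le> \<alpha>\<^sub>2 x"
    "\<And>x. x \<in> G \<Longrightarrow> orbital_derivative \<phi> V x \<le> ereal (\<rho> (V x))"
    using assms(9) by blast
  have inv: "\<phi> x t \<in> G" if "x \<in> G" "0 \<le> t" for x t
    using assms(3) that by (simp add: forward_invariant_def)
  interpret unique_flow \<rho> \<beta> by standard (rule assms(8))
  show ?thesis
    unfolding beta_stable_def
  proof (intro ballI allI impI)
    fix x and t :: real assume "x \<in> G" "0 \<le> t"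
    then have "x \<in> \<Omega>" using assms(2) by blast
    have start: "\<phi> x 0 = x"
      using assms(1) \<open>x \<in> \<Omega>\<close> by (simp add: solution_map_def solves_ode_on_def)
    have semigroup: "\<phi> (\<phi> x r) s = \<phi> x (r + s)" if "0 \<le> r" "0 \<le> s" for r s
      using assms(1) \<open>x \<in> \<Omega>\<close> that by (simp add: solution_map_def)
    have "continuous_on {0..} (\<phi> x)"
      using assms(1) \<open>x \<in> \<Omega>\<close> unfolding solution_map_def solves_ode_on_def
      by (auto simp: continuous_on_eq_continuous_within intro: has_vector_derivative_continuous)
    \<comment> \<open>By the semigroup property of \<open>\<phi>\<close>, the orbital derivative at \<open>\<phi> x
      r\<close> is the Dini derivative of \<open>V\<close> along the trajectory of \<open>x\<close> at time
      \<open>r\<close>.\<close>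
    interpret flow_subsolution \<rho> \<beta> "\<lambda>t. V (\<phi> x t)"
    proof
      show "continuous_on {0..} (\<lambda>t. V (\<phi> x t))"
        by (rule continuous_on_compose2[OF V(1) \<open>continuous_on {0..} (\<phi> x)\<close>])
          (use inv \<open>x \<in> G\<close> in auto)
    next
      fix r :: real assume "0 \<le> r"
      then have "\<phi> x r \<in> G" using inv \<open>x \<in> G\<close> by blast
      then show "0 \<le> V (\<phi> x r)" by (rule V(2))
      have "\<phi> (\<phi> x r) 0 = \<phi> x r" using semigroup[of r 0] \<open>0 \<le> r\<close> by simp
      then have "upper_right_Dini (\<lambda>s. V (\<phi> x s)) r = orbital_derivative \<phi> V (\<phi> x r)"
        unfolding orbital_derivative_def upper_right_Dini_def using \<open>0 \<le> r\<close> semigroup[of r]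
        by (intro Limsup_eq) (simp add: eventually_at_filter)
      then show "upper_right_Dini (\<lambda>s. V (\<phi> x s)) r \<le> ereal (\<rho> (V (\<phi> x r)))"
        using V(5)[OF \<open>\<phi> x r \<in> G\<close>] by simp
    qed
    have "\<alpha>\<^sub>1 (\<phi> x t) \<le> V (\<phi> x t)"
      using V(3) inv \<open>x \<in> G\<close> \<open>0 \<le> t\<close> by blast
    also have "\<dots> \<le> \<beta> (V x) t"
      using compare[OF \<open>0 \<le> t\<close>] by (simp add: start)
    also have "\<dots> \<le> \<beta> (\<alpha>\<^sub>2 x) t"
      using V \<open>x \<in> G\<close> \<open>0 \<le> t\<close> by (intro flow_mono) auto
    finally show "\<alpha>\<^sub>1 (\<phi> x t) \<le> \<beta> (\<alpha>\<^sub>2 x) t" .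
  qed
qed

end
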